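(* Fix $\mathbf q\in\operatorname{int}\mathcal Q$, $\gamma>0$, a block $\mathcal B\subseteq\{1,\dots,n\}$ with $|\mathcal B|\ge2$, and a sequence of step sizes $\beta_j>0$. Let $\{(\mathbf x^j,t^j)\}_{j=0}^{T}$ be generated from $\mathbf x^0\in\mathcal X$ by $$t^j\in\arg\min_{t\in\mathbb R} f^{\mathcal B}(\mathbf x^j,t;\mathbf q),\qquad \mathbf x^{j+1}=\operatorname{proj}_{\mathcal X}\big[\mathbf x^j-\beta_j\,G_{\mathbf x}(\mathbf x^j,t^j;\mathcal I)\big],$$ where $G_{\mathbf x}(\mathbf x,t;\mathcal I)$ is an unbiased mini-batch stochastic subgradient of $f^{\mathcal B}(\cdot,t;\mathbf q)$ at $\mathbf x$. Assume: (i) (bounded second moment) for all $\mathbf x\in\mathcal X$ and $t\in\mathbb R$, $\mathbb E\big[\|G_{\mathbf x}(\mathbf x,t;\mathcal I)\|_2^2\big]\le B^2$; (ii) (bounded domain) there exists $R<\infty$ such that $\|\mathbf x-\mathbf x^\star\|_2^2\le R^2$ for all $\mathbf x\in\mathcal X$, where $\mathbf x^\star\in\arg\min_{\mathbf x\in\mathcal X}\hat f^{\mathcal B}(\mathbf x;\mathbf q)$ and $\hat f^{\mathcal B}(\mathbf x;\mathbf q)=\min_{t\in\mathbb R}f^{\mathcal B}(\mathbf x,t;\mathbf q)$. Define the ergodic averages $\bar{\mathbf x}^T=\frac1T\sum_{j=0}^{T-1}\mathbf x^j$ and $\bar t^T=\frac1T\sum_{j=0}^{T-1}t^j$. Then $$\mathbb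 E\big[f^{\mathcal B}(\bar{\mathbf x}^T,\bar t^T;\mathbf q)-f^{\mathcal B}_*\big]\le\frac{R^2}{2T\beta_{T-1}}+\frac{1}{2T}\sum_{j=0}^{T-1}\beta_jB^2,$$ where $f^{\mathcal B}_*=\min_{\mathbf x\in\mathcal X,\,t\in\mathbb R}f^{\mathcal B}(\mathbf x,t;\mathbf q)$.
   Context: Setting. $\Omega=\{\omega_1,\dots,\omega_n\}$ is a finite sample space with probability vector $\mathbf p=(p_1,\dots,p_n)$, $\alpha\in(0,1)$, $\mathcal Q=\{\mathbf q\in\mathbb R^n:0\le q_i\le p_i/(1-\alpha)\ \forall i,\ \sum_iq_i=1\}$, and $\operatorname{int}\mathcal Q=\{\mathbf q\in\mathcal Q:0<q_i<p_i/(1-\alpha)\ \forall i\}$. $\mathcal X\subseteq\mathbb R^d$ is closed, convex, nonempty; $F:\mathcal X\times\Omega\to\mathbb R$ is convex in $\mathbf x$ for each $\omega$; $F_i(\mathbf x)=F(\mathbf x,\omega_i)$. For $\mathbf r\in\operatorname{int}\mathcal Q$ let $\nabla_i\psi(r_i)=\ln\frac{r_i}{p_i/(1-\alpha)-r_i}$ (the derivative of the generalized Fermi--Dirac entropy) and, for $\gamma>0$, $$h_i(\mathbf x,t;\mathbf r)=\ln\Big(1+\exp\big(\nabla_i\psi(r_i)+\gamma(F_i(\mathbf x)-t)\big)\Big).$$ The block subproblem objective is $$f^{\mathcal B}(\mathbf x,t;\mathbf r)=t+\sum_{i\notin\mathcal B}r_i\,(F_i(\mathbf x)-t)+\frac{1}{\gamma(1-\alpha)}\sum_{i\in\mathcal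 B}p_i\,h_i(\mathbf x,t;\mathbf r).$$ $\operatorname{proj}_{\mathcal X}$ is the Euclidean projection onto $\mathcal X$. Mini-batch: at each iteration $\mathcal I$ is a fresh nonempty multiset of indices drawn independently with replacement from $\{1,\dots,n\}$ (sampled from $\mathbf q$), independent of the past; "unbiased stochastic subgradient" means that $\mathbb E[G_{\mathbf x}(\mathbf x,t;\mathcal I)]$ belongs to the (convex) subdifferential of $f^{\mathcal B}(\cdot,t;\mathbf q)$ at $\mathbf x$, for all $\mathbf x\in\mathcal X$, $t\in\mathbb R$; in particular the same holds for conditional expectations given $(\mathbf x^j,t^j)$ along the iteration.
   Formalization: The step sizes are additionally assumed nonincreasing, β_{j+1} ≤ β_j for j+1 < T; for arbitrary positive step sizes the stated bound fails (e.g. F_i = |x| on [-1,1], T = 2, β_0 → 0, β_1 = 0.9). *)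

theory Defs
  imports "HOL-Probability.Probability"
begin

text \<open>The sample space is a finite type \<open>'n\<close>, so \<open>n = CARD('n)\<close>; the decision space is \<open>real^'d\<close>.\<close>

definition prob_vector :: "real^'n \<Rightarrow> bool" where
  "prob_vector p \<longleftrightarrow> (\<forall>i. 0 \<le> p $ i) \<and> (\<Sum>i\<in>UNIV. p $ i) = 1"

definition Qset :: "real \<Rightarrow> real^'n \<Rightarrow> (real^'n) set" where
  "Qset \<alpha> p = {q. (\<forall>i. 0 \<le> q $ i \<and> q $ i \<le> p $ i / (1 - \<alpha>)) \<and> (\<Sum>i\<in>UNIV. q $ i) = 1}"

text \<open>Not the topological interior, which is empty because of the constraint on the sum.\<close>

definition int_Q :: "real \<Rightarrow> real^'n \<Rightarrow> (real^'n) set" where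
  "int_Q \<alpha> p = {q \<in> Qset \<alpha> p. \<forall>i. 0 < q $ i \<and> q $ i < p $ i / (1 - \<alpha>)}"

text \<open>The \<open>i\<close>-th derivative of the generalized Fermi--Dirac entropy.\<close>

definition grad_psi :: "real \<Rightarrow> real^'n \<Rightarrow> 'n \<Rightarrow> real \<Rightarrow> real" where
  "grad_psi \<alpha> p i s = ln (s / (p $ i / (1 - \<alpha>) - s))"

definition h_fun ::
  "real \<Rightarrow> real^'n \<Rightarrow> real \<Rightarrow> (real^'d \<Rightarrow> 'n \<Rightarrow> real) \<Rightarrow> real^'n \<Rightarrow> 'n \<Rightarrow> real^'d \<Rightarrow> real \<Rightarrow> real" where
  "h_fun \<alpha> p \<gamma> F r i x t = ln (1 + exp (grad_psi \<alpha> p i (r $ i) + \<gamma> * (F x i - t)))"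

definition fB ::
  "real \<Rightarrow> real^'n \<Rightarrow> real \<Rightarrow> (real^'d \<Rightarrow> 'n \<Rightarrow> real) \<Rightarrow> 'n set \<Rightarrow> real^'n \<Rightarrow> real^'d \<Rightarrow> real \<Rightarrow> real" where
  "fB \<alpha> p \<gamma> F \<B> r x t =
     t + (\<Sum>i\<in>-\<B>. r $ i * (F x i - t))
       + 1 / (\<gamma> * (1 - \<alpha>)) * (\<Sum>i\<in>\<B>. p $ i * h_fun \<alpha> p \<gamma> F r i x t)"

text \<open>\<open>LEAST\<close> over a set of reals is its minimum (not merely its infimum).\<close>

definition fB_hat ::
  "real \<Rightarrow> real^'n \<Rightarrow> real \<Rightarrow> (real^'d \<Rightarrow> 'n \<Rightarrow> real) \<Rightarrow> 'n set \<Rightarrow> real^'n \<Rightarrow> real^'d \<Rightarrow> real" where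
  "fB_hat \<alpha> p \<gamma> F \<B> r x = (LEAST v. \<exists>t. v = fB \<alpha> p \<gamma> F \<B> r x t)"

definition fB_star ::
  "real \<Rightarrow> real^'n \<Rightarrow> real \<Rightarrow> (real^'d \<Rightarrow> 'n \<Rightarrow> real) \<Rightarrow> 'n set \<Rightarrow> real^'n \<Rightarrow> (real^'d) set \<Rightarrow> real" where
  "fB_star \<alpha> p \<gamma> F \<B> r X = (LEAST v. \<exists>x\<in>X. \<exists>t. v = fB \<alpha> p \<gamma> F \<B> r x t)"

text \<open>Convex subdifferential at \<open>x\<close> of a function whose domain is \<open>X\<close>: the values of \<open>f\<close>
  outside \<open>X\<close> play no role, as \<open>F\<close> is only given on \<open>X\<close>.\<close>

definition subdifferential :: "(real^'d) set \<Rightarrow> (real^'d \<Rightarrow> real) \<Rightarrow> real^'d \<Rightarrow> (real^'d) set" where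
  "subdifferential X f x = {g. \<forall>y\<in>X. f x + g \<bullet> (y - x) \<le> f y}"

text \<open>\<open>\<xi> j k\<close> is the \<open>k\<close>-th index drawn in iteration \<open>j\<close>, in which \<open>m j\<close> indices are drawn.\<close>

definition minibatch :: "(nat \<Rightarrow> nat) \<Rightarrow> (nat \<Rightarrow> nat \<Rightarrow> 's \<Rightarrow> 'n) \<Rightarrow> nat \<Rightarrow> 's \<Rightarrow> 'n multiset" where
  "minibatch m \<xi> j \<omega> = image_mset (\<lambda>k. \<xi> j k \<omega>) (mset_set {..<m j})"

text \<open>All draws of the first \<open>T\<close> iterations are independent with law \<open>q\<close>; in particular each
  minibatch is independent of the preceding ones.\<close>

definition minibatch_sampling ::
  "'s measure \<Rightarrow> real^'n \<Rightarrow> nat \<Rightarrow> (nat \<Rightarrow> nat) \<Rightarrow> (nat \<Rightarrow> nat \<Rightarrow> 's \<Rightarrow> 'n) \<Rightarrow> bool" where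
  "minibatch_sampling M q T m \<xi> \<longleftrightarrow>
     prob_space M \<and>
     (\<forall>j<T. 1 \<le> m j) \<and>
     prob_space.indep_vars M (\<lambda>_. count_space UNIV) (\<lambda>(j, k). \<xi> j k) (SIGMA j:{..<T}. {..<m j}) \<and>
     (\<forall>j<T. \<forall>k<m j. \<forall>i. measure M {\<omega> \<in> space M. \<xi> j k \<omega> = i} = q $ i)"

end

theory Submission
  imports Defs
begin

text \<open>
  The function \<^const>\<open>fB\<close> is jointly convex in \<open>(x, t)\<close> and differentiable in \<open>t\<close>. Hence, if
  \<open>t\<close> minimises \<open>fB x\<close> and \<open>g\<close> is a subgradient in \<open>x\<close> alone, then \<open>(g, 0)\<close> is a joint
  subgradient, so that the iteration obeys the usual one-step estimate of the projected stochastic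
  subgradient method against the pair \<open>(xstar, tstar)\<close>. Dividing by \<open>\<beta> j\<close>, summing by parts
  (the step sizes do not increase) and applying Jensen's inequality to the averages gives the bound.
  As \<open>fB x\<close> is strictly convex in \<open>t\<close>, its minimiser is unique, and the iterates are functions of
  the finitely many past draws. So the conditional expectations are finite sums over histories,
  and no measurability question about the choice of \<open>t\<close> arises.
\<close>

section \<open>The softplus function and tools for convexity\<close>

definition softplus :: "real \<Rightarrow> real" where
  "softplus a = ln (1 + exp a)"

text \<open>The derivative is the logistic function, written through \<open>softplus\<close> itself,
  so that monotonicity and limits of \<open>df\<close> later reduce to those of
  \<open>softplus\<close>.\<close>

lemma softplus_deriv [derivative_intros]:
  assumes "(g has_real_derivative g') (at a within S)"
  shows "((\<lambda>a. softplus (g a)) has_real_derivative (1 - exp (- softplus (g a))) * g') (at a within S)"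
proof -
  have pos: "0 < 1 + exp (g a)"
    by (simp add: add_pos_pos)
  then have "1 - exp (- softplus (g a)) = exp (g a) / (1 + exp (g a))"
    by (simp add: softplus_def exp_minus field_simps)
  then show ?thesis
    unfolding softplus_def using pos
    by (auto intro!: derivative_eq_intros assms simp: field_simps)
qed

lemma softplus_less_iff: "softplus a < softplus b \<longleftrightarrow> a < b"
  by (simp add: softplus_def add_pos_pos)

lemma softplus_le_iff: "softplus a \<le> softplus b \<longleftrightarrow> a \<le> b"
  by (simp add: softplus_def add_pos_pos)

lemma convex_on_softplus: "convex_on UNIV softplus"
proof (rule convex_on_realI)
  show "(softplus has_real_derivative 1 - exp (- softplus a)) (at a)" for a
    using softplus_deriv[OF DERIV_ident] by simp
qed (auto simp: softplus_le_iff)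

lemma convex_on_softplus_compose:
  assumes "convex_on S g"
  shows "convex_on S (\<lambda>z. softplus (g z))"
proof (rule convex_onI)
  fix u :: real and x y
  assume *: "0 < u" "u < 1" "x \<in> S" "y \<in> S"
  then have "softplus (g ((1 - u) *\<^sub>R x + u *\<^sub>R y)) \<le> softplus ((1 - u) * g x + u * g y)"
    using convex_onD[OF assms, of u x y] by (simp add: softplus_le_iff)
  also have "\<dots> \<le> (1 - u) * softplus (g x) + u * softplus (g y)"
    using convex_onD[OF convex_on_softplus, of u "g x" "g y"] * by simp
  finally show "softplus (g ((1 - u) *\<^sub>R x + u *\<^sub>R y)) \<le> (1 - u) * softplus (g x) + u * softplus (g y)" .
qed (rule convex_on_imp_convex[OF assms])

lemma convex_on_sum_fun:
  assumes "finite I" "convex S" "\<And>i. i \<in> I \<Longrightarrow> convex_on S (f i)"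
  shows "convex_on S (\<lambda>z. \<Sum>i\<in>I. f i z)"
  using assms(1,3)
  by (induction I rule: finite_induct) (auto simp: convex_on_const assms(2))

lemma is_arg_min_UNIV_iff:
  fixes f :: "'a \<Rightarrow> 'b::linorder"
  shows "is_arg_min f (\<lambda>_. True) s \<longleftrightarrow> (\<forall>s'. f s \<le> f s')"
  by (simp add: is_arg_min_def not_less)

section \<open>The block objective: convexity, derivative and minimiser in \<open>t\<close>, joint
  subgradients\<close>

locale block_objective =
  fixes \<alpha> \<gamma> :: real and p q :: "real^'n" and F :: "real^'d \<Rightarrow> 'n \<Rightarrow> real"
    and \<B> :: "'n set" and X :: "(real^'d) set"
  assumes alpha: "\<alpha> < 1" and gamma: "0 < \<gamma>" and q: "q \<in> int_Q \<alpha> p"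
    and block: "\<B> \<noteq> {}" and convex_X: "convex X"
    and convex_F: "\<And>i. convex_on X (\<lambda>y. F y i)"
begin

abbreviation f :: "real^'d \<Rightarrow> real \<Rightarrow> real" where
  "f \<equiv> fB \<alpha> p \<gamma> F \<B> q"

text \<open>The upper bound on the \<open>i\<close>-th coordinate in \<open>Qset\<close>.\<close>

definition P :: "'n \<Rightarrow> real" where
  "P i = p $ i / (1 - \<alpha>)"

abbreviation H :: "'n \<Rightarrow> real^'d \<Rightarrow> real \<Rightarrow> real" where
  "H i x t \<equiv> softplus (grad_psi \<alpha> p i (q $ i) + \<gamma> * (F x i - t))"

text \<open>The derivative of \<open>f x\<close>; the factor \<open>1 - exp (- H i x t)\<close> is
  the logistic function. Only block indices occur because \<open>q\<close> sums to 1.\<close>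

definition df :: "real^'d \<Rightarrow> real \<Rightarrow> real" where
  "df x t = (\<Sum>i\<in>\<B>. q $ i - P i * (1 - exp (- H i x t)))"

lemma q_bounds: "0 < q $ i" "q $ i < P i" "0 < P i"
proof -
  show "0 < q $ i" "q $ i < P i"
    using q by (auto simp: int_Q_def P_def)
  then show "0 < P i"
    by linarith
qed

text \<open>Since \<open>q\<close> sums to 1, the leading \<open>t\<close> and the terms
  \<open>- q $ i * t\<close> outside the block merge into one linear term; each summand is then
  convex in the pair.\<close>

lemma f_eq:
  "f x t = (\<Sum>i\<in>\<B>. q $ i) * t + (\<Sum>i\<in>-\<B>. q $ i * F x i) + (\<Sum>i\<in>\<B>. P i / \<gamma> * H i x t)"
proof -
  have "(\<Sum>i\<in>\<B>. q $ i) + (\<Sum>i\<in>-\<B>. q $ i) = 1"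
    using q sum.subset_diff[of \<B> UNIV "\<lambda>i. q $ i"]
    by (simp add: int_Q_def Qset_def Compl_eq_Diff_UNIV)
  then have "t = (\<Sum>i\<in>\<B>. q $ i) * t + (\<Sum>i\<in>-\<B>. q $ i) * t"
    by (simp flip: distrib_right)
  then show ?thesis
    unfolding fB_def h_fun_def softplus_def[symmetric] P_def
    by (simp add: sum_distrib_left sum_distrib_right right_diff_distrib sum_subtractf mult_ac)
qed

lemma convex_on_fst: "convex_on (X \<times> UNIV) (\<lambda>z. F (fst z) i)"
  using convex_F[of i] convex_Times[OF convex_X convex_UNIV] by (auto simp: convex_on_def)

lemma convex_on_snd: "convex_on (X \<times> UNIV) (\<lambda>z. c * snd z)" for c :: real
  using convex_Times[OF convex_X convex_UNIV] by (auto simp: convex_on_def algebra_simps)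

lemma convex_on_H: "convex_on (X \<times> UNIV) (\<lambda>z. H i (fst z) (snd z))"
proof (rule convex_on_softplus_compose)
  have "convex_on (X \<times> UNIV) (\<lambda>z. \<gamma> * F (fst z) i)"
    using convex_on_cmul[OF _ convex_on_fst, of \<gamma>] gamma by simp
  from convex_on_add[OF convex_on_add[OF this convex_on_snd[of "-\<gamma>"]], of "\<lambda>_. grad_psi \<alpha> p i (q $ i)"]
  show "convex_on (X \<times> UNIV) (\<lambda>z. grad_psi \<alpha> p i (q $ i) + \<gamma> * (F (fst z) i - snd z))"
    using convex_Times[OF convex_X convex_UNIV] by (simp add: convex_on_const algebra_simps)
qed

text \<open>The choice \<open>I = \<B>\<close> gives convexity of \<open>f\<close>, and
  \<open>I = \<B> - {i}\<close> isolates a single softplus term in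
  \<open>df_tendsto_segment\<close>.\<close>

lemma convex_on_partial:
  assumes "I \<subseteq> \<B>"
  shows "convex_on (X \<times> UNIV) (\<lambda>z. (\<Sum>i\<in>\<B>. q $ i) * snd z + (\<Sum>i\<in>-\<B>. q $ i * F (fst z) i)
    + (\<Sum>i\<in>I. P i / \<gamma> * H i (fst z) (snd z)))"
proof (intro convex_on_add convex_on_snd convex_on_sum_fun convex_Times convex_X convex_UNIV finite)
  show "convex_on (X \<times> UNIV) (\<lambda>z. q $ i * F (fst z) i)" for i
    using q_bounds(1)[of i] by (intro convex_on_cmul convex_on_fst) simp
  show "convex_on (X \<times> UNIV) (\<lambda>z. P i / \<gamma> * H i (fst z) (snd z))" for i
    using q_bounds(3)[of i] gamma by (intro convex_on_cmul convex_on_H divide_nonneg_pos) auto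
qed

lemma convex_on_f: "convex_on (X \<times> UNIV) (\<lambda>z. f (fst z) (snd z))"
  using convex_on_partial[of \<B>] by (simp add: f_eq)

lemma f_has_derivative: "(f x has_real_derivative df x t) (at t)"
proof -
  have "((\<lambda>t. (\<Sum>i\<in>\<B>. q $ i) * t + (\<Sum>i\<in>-\<B>. q $ i * F x i) + (\<Sum>i\<in>\<B>. P i / \<gamma> * H i x t))
    has_real_derivative (\<Sum>i\<in>\<B>. q $ i) + (\<Sum>i\<in>\<B>. P i / \<gamma> * ((1 - exp (- H i x t)) * (- \<gamma>)))) (at t)"
    using gamma by (auto intro!: derivative_eq_intros sum.cong)
  also have "(\<Sum>i\<in>\<B>. q $ i) + (\<Sum>i\<in>\<B>. P i / \<gamma> * ((1 - exp (- H i x t)) * (- \<gamma>))) = df x t"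
    using gamma by (simp add: df_def sum_subtractf sum_negf)
  finally show ?thesis
    by (simp add: f_eq[abs_def])
qed

text \<open>Each summand increases strictly because \<open>P i\<close> and \<open>\<gamma>\<close>
  are positive; nonemptiness of the block keeps the sum strict.\<close>

lemma df_strict_mono:
  assumes "s < t"
  shows "df x s < df x t"
  unfolding df_def
proof (rule sum_strict_mono)
  fix i
  have "H i x t < H i x s"
    using assms gamma by (simp add: softplus_less_iff)
  then have "P i * (1 - exp (- H i x t)) < P i * (1 - exp (- H i x s))"
    using q_bounds(3)[of i] by (intro mult_strict_left_mono) auto
  then show "q $ i - P i * (1 - exp (- H i x s)) < q $ i - P i * (1 - exp (- H i x t))"
    by linarith
qed (use block in auto)

lemma df_mono: "s \<le> t \<Longrightarrow> df x s \<le> df x t"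
  using df_strict_mono[of s t x] by (cases "s = t") auto

lemma f_tangent: "f x t + (s - t) * df x t \<le> f x s"
proof -
  have "convex_on UNIV (f x)"
    by (rule convex_on_realI[where f' = "df x"]) (auto intro: f_has_derivative df_mono)
  then have "(s - t) * df x t \<le> f x s - f x t"
    using convex_on_imp_above_tangent[of UNIV "f x" t s "df x t"] f_has_derivative[of x t]
    by (simp add: mult.commute)
  then show ?thesis by simp
qed

lemma continuous_df: "continuous_on S (df x)"
proof -
  have "1 + exp a \<noteq> 0" for a :: real
    using add_pos_pos[of 1 "exp a"] by simp
  then show ?thesis
    unfolding df_def softplus_def by (intro continuous_intros) auto
qed

text \<open>At \<open>t = F x i\<close> the \<open>i\<close>-th summand of \<^term>\<open>df x\<close> vanishes, since the logistic function
  inverts \<^const>\<open>grad_psi\<close>; so \<^term>\<open>df x\<close> changes sign between the extreme values of \<^term>\<open>F x\<close>.\<close>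

lemma df_zero_exists: "\<exists>t. df x t = 0"
proof -
  define g where "g i t = q $ i - P i * (1 - exp (- H i x t))" for i t
  have g0: "g i (F x i) = 0" for i
  proof -
    have "0 < q $ i / (P i - q $ i)"
      using q_bounds[of i] by simp
    then have "exp (- H i x (F x i)) = 1 / (1 + q $ i / (P i - q $ i))"
      by (simp add: grad_psi_def P_def[symmetric] softplus_def exp_minus add_pos_pos inverse_eq_divide)
    also have "1 + q $ i / (P i - q $ i) = P i / (P i - q $ i)"
      using q_bounds[of i] by (simp add: field_simps)
    finally have "exp (- H i x (F x i)) = (P i - q $ i) / P i" by simp
    then have "P i * (1 - exp (- H i x (F x i))) = P i - P i * ((P i - q $ i) / P i)"
      by (simp only: right_diff_distrib mult_1_right)
    also have "P i * ((P i - q $ i) / P i) = P i - q $ i"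
      using q_bounds(3)[of i] by simp
    finally show ?thesis
      unfolding g_def by linarith
  qed
  have g_mono: "g i s \<le> g i t" if "s \<le> t" for i s t
    using that gamma q_bounds(3)[of i] unfolding g_def
    by (intro diff_left_mono mult_left_mono) (auto simp: softplus_le_iff)
  have fin: "finite (range (F x))" by simp
  have "df x (Min (range (F x))) \<le> 0"
    unfolding df_def g_def[symmetric]
    by (rule sum_nonpos) (metis fin g0 g_mono Min_le rangeI)
  moreover have "0 \<le> df x (Max (range (F x)))"
    unfolding df_def g_def[symmetric]
    by (rule sum_nonneg) (metis fin g0 g_mono Max_ge rangeI)
  moreover have "Min (range (F x)) \<le> Max (range (F x))"
    by simp
  ultimately show ?thesis
    using IVT'[of "df x" "Min (range (F x))" 0 "Max (range (F x))"] continuous_df by blast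
qed

lemma arg_min_iff_df: "is_arg_min (f x) (\<lambda>_. True) t \<longleftrightarrow> df x t = 0"
proof
  assume "is_arg_min (f x) (\<lambda>_. True) t"
  then have "\<forall>s. f x t \<le> f x s"
    by (simp add: is_arg_min_UNIV_iff)
  then show "df x t = 0"
    using DERIV_local_min[OF f_has_derivative[of x t], of 1] by simp
next
  assume "df x t = 0"
  then show "is_arg_min (f x) (\<lambda>_. True) t"
    using f_tangent[of x t] by (simp add: is_arg_min_UNIV_iff)
qed

lemma arg_min_unique:
  assumes "is_arg_min (f x) (\<lambda>_. True) s" "is_arg_min (f x) (\<lambda>_. True) t"
  shows "s = t"
  using assms df_strict_mono[of s t x] df_strict_mono[of t s x]
  by (cases rule: linorder_cases[of s t]) (auto simp: arg_min_iff_df)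

lemma arg_min_exists: "\<exists>t. is_arg_min (f x) (\<lambda>_. True) t"
  using df_zero_exists[of x] by (simp add: arg_min_iff_df)

lemma fB_hat_eq:
  assumes "is_arg_min (f x) (\<lambda>_. True) t"
  shows "fB_hat \<alpha> p \<gamma> F \<B> q x = f x t"
  unfolding fB_hat_def using assms by (intro Least_equality) (auto simp: is_arg_min_UNIV_iff)

text \<open>Minimising over \<open>t\<close> first and over the decision afterwards reaches the
  joint minimum. A minimising \<open>t'\<close> exists for every competitor, so
  \<open>fB_hat\<close> is an attained value there.\<close>

lemma fB_star_eq:
  assumes "is_arg_min (fB_hat \<alpha> p \<gamma> F \<B> q) (\<lambda>y. y \<in> X) xs" "is_arg_min (f xs) (\<lambda>_. True) ts"
  shows "fB_star \<alpha> p \<gamma> F \<B> q X = f xs ts"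
  unfolding fB_star_def
proof (rule Least_equality)
  show "\<exists>x\<in>X. \<exists>t. f xs ts = f x t"
    using assms(1) by (auto simp: is_arg_min_def)
next
  fix v assume "\<exists>x\<in>X. \<exists>t. v = f x t"
  then obtain x t where xt: "x \<in> X" "v = f x t" by blast
  obtain t' where t': "is_arg_min (f x) (\<lambda>_. True) t'"
    using arg_min_exists by blast
  have "f xs ts \<le> f x t'"
    using assms xt fB_hat_eq[OF assms(2)] fB_hat_eq[OF t'] by (auto simp: is_arg_min_def not_less)
  also have "\<dots> \<le> v"
    using t' xt by (simp add: is_arg_min_UNIV_iff)
  finally show "f xs ts \<le> v" .
qed

text \<open>The functions \<open>F\<close> may jump at the relative boundary of \<open>X\<close>. Each summand of
  \<^const>\<open>fB\<close> is bounded above along a segment by convexity, so the subgradient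
  inequality bounds each of them below too, which yields continuity of \<^const>\<open>df\<close> along
  the segment.\<close>

lemma df_tendsto_segment:
  assumes x: "x \<in> X" and y: "y \<in> X" and g: "g \<in> subdifferential X (\<lambda>z. f z t) x"
  shows "((\<lambda>l. df (x + l *\<^sub>R (y - x)) t) \<longlongrightarrow> df x t) (at_right 0)"
proof -
  have "((\<lambda>l. H i (x + l *\<^sub>R (y - x)) t) \<longlongrightarrow> H i x t) (at_right 0)" if i: "i \<in> \<B>" for i
  proof -
    \<comment> \<open>Everything in \<open>f\<close> except the \<open>i\<close>-th softplus term;
      convex by \<open>convex_on_partial\<close>.\<close>
    define K where "K z = (\<Sum>i\<in>\<B>. q $ i) * t + (\<Sum>i\<in>-\<B>. q $ i * F z i)
      + (\<Sum>i\<in>\<B>-{i}. P i / \<gamma> * H i z t)" for z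
    have f_split: "f z t = K z + P i / \<gamma> * H i z t" for z
      using sum.remove[OF finite i, of "\<lambda>i. P i / \<gamma> * H i z t"] by (simp add: f_eq K_def)
    have pos: "0 < P i / \<gamma>"
      using q_bounds(3)[of i] gamma by (rule divide_pos_pos)
    \<comment> \<open>The slope that the subgradient inequality leaves to \<open>H i\<close> once
      \<open>K\<close> is bounded by its chord.\<close>
    define c where "c = (g \<bullet> (y - x) - (K y - K x)) / (P i / \<gamma>)"
    have *: "H i x t + l * c \<le> H i (x + l *\<^sub>R (y - x)) t
        \<and> H i (x + l *\<^sub>R (y - x)) t \<le> H i x t + l * (H i y t - H i x t)"
      if l: "0 < l" "l < 1" for l
    proof
      have u: "x + l *\<^sub>R (y - x) = (1 - l) *\<^sub>R x + l *\<^sub>R y"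
        by (simp add: algebra_simps)
      have uX: "x + l *\<^sub>R (y - x) \<in> X"
        unfolding u using convexD_alt[OF convex_X x y] l by simp
      show "H i (x + l *\<^sub>R (y - x)) t \<le> H i x t + l * (H i y t - H i x t)"
        using convex_onD[OF convex_on_H, of l "(x, t)" "(y, t)" i] x y l
        by (simp add: u algebra_simps)
      have "K (x + l *\<^sub>R (y - x)) \<le> (1 - l) * K x + l * K y"
        using convex_onD[OF convex_on_partial[of "\<B> - {i}"], of l "(x, t)" "(y, t)"] x y l
        by (simp add: u K_def flip: distrib_right)
      moreover have "f x t + l * (g \<bullet> (y - x)) \<le> f (x + l *\<^sub>R (y - x)) t"
        using g uX by (auto simp: subdifferential_def dest: bspec)
      ultimately have "l * (g \<bullet> (y - x) - (K y - K x))
          \<le> P i / \<gamma> * (H i (x + l *\<^sub>R (y - x)) t - H i x t)"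
        unfolding f_split by (simp add: algebra_simps)
      then have "l * (g \<bullet> (y - x) - (K y - K x)) / (P i / \<gamma>)
          \<le> H i (x + l *\<^sub>R (y - x)) t - H i x t"
        using pos by (subst pos_divide_le_eq) (simp_all only: mult.commute)
      then show "H i x t + l * c \<le> H i (x + l *\<^sub>R (y - x)) t"
        unfolding c_def times_divide_eq_right by linarith
    qed
    have ev: "eventually (\<lambda>l::real. 0 < l \<and> l < 1) (at_right 0)"
      using eventually_at_right_real[of 0 "1::real"] by simp
    show ?thesis
    proof (rule tendsto_sandwich)
      show "eventually (\<lambda>l. H i x t + l * c \<le> H i (x + l *\<^sub>R (y - x)) t) (at_right 0)"
        "eventually (\<lambda>l. H i (x + l *\<^sub>R (y - x)) t \<le> H i x t + l * (H i y t - H i x t)) (at_right 0)"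
        using ev by (rule eventually_mono, use * in blast)+
      have "((\<lambda>l. H i x t + l * d) \<longlongrightarrow> H i x t + 0 * d) (at_right 0)" for d
        by (intro tendsto_intros)
      from this[of c] this[of "H i y t - H i x t"]
      show "((\<lambda>l. H i x t + l * c) \<longlongrightarrow> H i x t) (at_right 0)"
        "((\<lambda>l. H i x t + l * (H i y t - H i x t)) \<longlongrightarrow> H i x t) (at_right 0)"
        by (simp_all only: mult_zero_left add_0_right)
    qed
  qed
  then show ?thesis
    unfolding df_def by (intro tendsto_intros) auto
qed

text \<open>From \<open>(x, t)\<close>, go the fraction \<open>l\<close> towards
  \<open>(y, s)\<close>: first in the decision, where \<open>g\<close> bounds the change, then in
  \<open>t\<close>, where the tangent at the new point \<open>u\<close> does. Convexity bounds the
  value reached by the chord; divide by \<open>l\<close> and let \<open>l\<close> tend to 0. The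
  slope \<open>df u t\<close> tends to \<open>df x t\<close>, which is 0 at a minimiser.\<close>

lemma joint_subgradient:
  assumes x: "x \<in> X" and y: "y \<in> X" and g: "g \<in> subdifferential X (\<lambda>z. f z t) x"
    and t: "is_arg_min (f x) (\<lambda>_. True) t"
  shows "f x t + g \<bullet> (y - x) \<le> f y s"
proof -
  have *: "g \<bullet> (y - x) + (s - t) * df (x + l *\<^sub>R (y - x)) t \<le> f y s - f x t"
    if l: "0 < l" "l < 1" for l
  proof -
    define u where "u = x + l *\<^sub>R (y - x)"
    have u: "u = (1 - l) *\<^sub>R x + l *\<^sub>R y"
      by (simp add: u_def algebra_simps)
    have uX: "u \<in> X"
      unfolding u using convexD_alt[OF convex_X x y] l by simp
    have "f x t + l * (g \<bullet> (y - x)) \<le> f u t"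
      using g uX by (auto simp: subdifferential_def u_def dest: bspec)
    moreover have "f u t + l * (s - t) * df u t \<le> f u (t + l * (s - t))"
      using f_tangent[of u t "t + l * (s - t)"] by simp
    moreover have "f u (t + l * (s - t)) \<le> (1 - l) * f x t + l * f y s"
      using convex_onD[OF convex_on_f, of l "(x, t)" "(y, s)"] x y l
      by (simp add: u algebra_simps)
    ultimately have "l * (g \<bullet> (y - x) + (s - t) * df u t) \<le> l * (f y s - f x t)"
      by (simp add: algebra_simps)
    then show ?thesis
      using l by (simp add: u_def)
  qed
  have "((\<lambda>l. g \<bullet> (y - x) + (s - t) * df (x + l *\<^sub>R (y - x)) t) \<longlongrightarrow> g \<bullet> (y - x) + (s - t) * df x t) (at_right 0)"
    by (intro tendsto_intros df_tendsto_segment[OF x y g])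
  moreover have "eventually (\<lambda>l. g \<bullet> (y - x) + (s - t) * df (x + l *\<^sub>R (y - x)) t \<le> f y s - f x t) (at_right 0)"
    using eventually_at_right_real[of 0 "1::real"] by (rule eventually_mono) (use * in auto)
  ultimately have "g \<bullet> (y - x) + (s - t) * df x t \<le> f y s - f x t"
    by (intro tendsto_upperbound) auto
  then show ?thesis
    using t by (simp add: arg_min_iff_df)
qed

end

section \<open>Finitely valued random variables and independence\<close>

text \<open>A function of a finitely valued variable is bounded, and it is measurable because the
  value space is discrete.\<close>

lemma (in prob_space) integrable_factor:
  fixes \<phi> :: "'a \<Rightarrow> 'c::{banach, second_countable_topology}"
  assumes V: "V \<in> M \<rightarrow>\<^sub>M count_space S" and "finite S"
    and eq: "\<And>\<omega> \<omega>'. \<omega> \<in> space M \<Longrightarrow> \<omega>' \<in> space M \<Longrightarrow> V \<omega> = V \<omega>' \<Longrightarrow> \<phi> \<omega> = \<phi> \<omega>'"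
  shows "integrable M \<phi>"
proof -
  \<comment> \<open>\<open>u\<close> evaluates \<open>\<phi>\<close> at a chosen outcome with the
    given value of \<open>V\<close>. At values never taken it is arbitrary, which can only enlarge
    the bound used below.\<close>
  define u where "u v = \<phi> (inv_into (space M) V v)" for v
  have u: "\<phi> \<omega> = u (V \<omega>)" if "\<omega> \<in> space M" for \<omega>
    unfolding u_def by (rule eq) (use that in \<open>auto intro: inv_into_into simp: f_inv_into_f\<close>)
  have VS: "V \<omega> \<in> S" if "\<omega> \<in> space M" for \<omega>
    using measurable_space[OF V that] by simp
  have "integrable M (\<lambda>\<omega>. u (V \<omega>))"
  proof (rule integrable_const_bound[where B = "\<Sum>v\<in>S. norm (u v)"])
    show "AE \<omega> in M. norm (u (V \<omega>)) \<le> (\<Sum>v\<in>S. norm (u v))"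
      using VS \<open>finite S\<close> member_le_sum[of _ S "\<lambda>v. norm (u v)"] by (intro AE_I2) simp
    show "(\<lambda>\<omega>. u (V \<omega>)) \<in> borel_measurable M"
      by (rule measurable_compose[OF V]) simp
  qed
  then show ?thesis
    by (rule iffD2[OF Bochner_Integration.integrable_cong[OF refl], rotated]) (rule u)
qed

text \<open>Stands in for conditioning on \<open>V\<close>: the expectation is split over the values
  \<open>v\<close> of \<open>V\<close>, and independence factors each term into the probability of
  \<open>v\<close> times the mean of \<open>\<psi> v (W \<omega>)\<close>.\<close>

lemma (in prob_space) expectation_freeze_le:
  fixes \<psi> :: "'b \<Rightarrow> 'b \<Rightarrow> real"
  assumes indep: "indep_var (count_space S) V (count_space S') W"
    and fin: "finite S" "finite S'"
    and le: "\<And>\<omega>. \<omega> \<in> space M \<Longrightarrow> expectation (\<lambda>\<omega>'. \<psi> (V \<omega>) (W \<omega>')) \<le> c"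
  shows "expectation (\<lambda>\<omega>. \<psi> (V \<omega>) (W \<omega>)) \<le> c"
proof -
  have V: "V \<in> M \<rightarrow>\<^sub>M count_space S" and W: "W \<in> M \<rightarrow>\<^sub>M count_space S'"
    using indep_var_rv1[OF indep] indep_var_rv2[OF indep] by auto
  have VS: "V \<omega> \<in> S" if "\<omega> \<in> space M" for \<omega>
    using measurable_space[OF V that] by simp
  have int1: "integrable M (\<lambda>\<omega>. indicator {v} (V \<omega>) :: real)" for v
    by (rule integrable_factor[OF V fin(1)]) simp
  have int2: "integrable M (\<lambda>\<omega>. \<psi> v (W \<omega>))" for v
    by (rule integrable_factor[OF W fin(2)]) simp
  have ind: "indep_var borel (\<lambda>\<omega>. indicator {v} (V \<omega>) :: real) borel (\<lambda>\<omega>. \<psi> v (W \<omega>))" for v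
    using indep_var_compose[OF indep, of "indicator {v}" borel "\<psi> v" borel] by (simp add: o_def)
  have "expectation (\<lambda>\<omega>. \<psi> (V \<omega>) (W \<omega>)) = expectation (\<lambda>\<omega>. \<Sum>v\<in>S. indicator {v} (V \<omega>) * \<psi> v (W \<omega>))"
  proof (rule Bochner_Integration.integral_cong[OF refl])
    fix \<omega> assume "\<omega> \<in> space M"
    then show "\<psi> (V \<omega>) (W \<omega>) = (\<Sum>v\<in>S. indicator {v} (V \<omega>) * \<psi> v (W \<omega>))"
      using sum.remove[OF fin(1) VS, of \<omega> "\<lambda>v. indicator {v} (V \<omega>) * \<psi> v (W \<omega>)"]
      by (simp add: indicator_def sum.neutral)
  qed
  also have "\<dots> = (\<Sum>v\<in>S. expectation (\<lambda>\<omega>. indicator {v} (V \<omega>)) * expectation (\<lambda>\<omega>. \<psi> v (W \<omega>)))"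
    using indep_var_integrable[OF ind int1 int2] indep_var_lebesgue_integral[OF ind int1 int2] by simp
  also have "\<dots> \<le> (\<Sum>v\<in>S. expectation (\<lambda>\<omega>. indicator {v} (V \<omega>)) * c)"
  proof (rule sum_mono)
    fix v
    show "expectation (\<lambda>\<omega>. indicator {v} (V \<omega>)) * expectation (\<lambda>\<omega>. \<psi> v (W \<omega>))
      \<le> expectation (\<lambda>\<omega>. indicator {v} (V \<omega>)) * c"
    proof (cases "v \<in> V ` space M")
      case True
      then show ?thesis
        using le by (intro mult_left_mono) auto
    next
      \<comment> \<open>The hypothesis says nothing about a value \<open>v\<close> that
        \<open>V\<close> never takes, but its weight is 0.\<close>
      case False
      then have "expectation (\<lambda>\<omega>. indicator {v} (V \<omega>) :: real) = expectation (\<lambda>\<omega>. 0)"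
        by (intro Bochner_Integration.integral_cong) (auto simp: indicator_def)
      then show ?thesis by simp
    qed
  qed
  also have "\<dots> = expectation (\<lambda>\<omega>. \<Sum>v\<in>S. indicator {v} (V \<omega>)) * c"
    using int1 by (simp add: sum_distrib_right)
  also have "expectation (\<lambda>\<omega>. \<Sum>v\<in>S. indicator {v} (V \<omega>)) = expectation (\<lambda>\<omega>. 1)"
    using VS fin(1) by (intro Bochner_Integration.integral_cong) (auto simp: indicator_def of_bool_def)
  finally show ?thesis
    by (simp add: prob_space)
qed

section \<open>Inequalities for the projected subgradient method\<close>

text \<open>Summation by parts as an induction. The bound keeps \<open>C - D (Suc n)\<close>, which
  is nonnegative in the induction step, so replacing \<open>\<beta> n\<close> by the smaller
  \<open>\<beta> (Suc n)\<close> does not decrease the quotient.\<close>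

lemma telescoping_weighted_le:
  fixes D \<beta> :: "nat \<Rightarrow> real"
  assumes "\<And>j. j \<le> n \<Longrightarrow> 0 < \<beta> j" "\<And>j. j < n \<Longrightarrow> \<beta> (Suc j) \<le> \<beta> j"
    and "\<And>j. j \<le> n \<Longrightarrow> D j \<le> C"
  shows "(\<Sum>j\<le>n. (D j - D (Suc j)) / \<beta> j) \<le> (C - D (Suc n)) / \<beta> n"
  using assms
proof (induction n)
  case 0
  then show ?case by (simp add: divide_right_mono less_imp_le)
next
  case (Suc n)
  have "(\<Sum>j\<le>Suc n. (D j - D (Suc j)) / \<beta> j)
      \<le> (C - D (Suc n)) / \<beta> n + (D (Suc n) - D (Suc (Suc n))) / \<beta> (Suc n)"
    using Suc by simp
  also have "(C - D (Suc n)) / \<beta> n \<le> (C - D (Suc n)) / \<beta> (Suc n)"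
    using Suc.prems by (intro divide_left_mono) auto
  finally show ?case
    by (simp add: diff_divide_distrib)
qed

text \<open>The projection is nonexpansive and fixes \<open>z\<close>; the rest is the expansion of
  a square.\<close>

lemma norm_projected_step_le:
  fixes X :: "'a::euclidean_space set"
  assumes "closed X" "convex X" "z \<in> X"
  shows "(norm (closest_point X (y - b *\<^sub>R g) - z))\<^sup>2
    \<le> (norm (y - z))\<^sup>2 - 2 * b * (g \<bullet> (y - z)) + b\<^sup>2 * (norm g)\<^sup>2"
proof -
  have "norm (closest_point X (y - b *\<^sub>R g) - z) \<le> norm (y - b *\<^sub>R g - z)"
    using closest_point_lipschitz[OF assms(2,1), of "y - b *\<^sub>R g" z] assms(3)
    by (auto simp: closest_point_self dist_norm)
  then have "(norm (closest_point X (y - b *\<^sub>R g) - z))\<^sup>2 \<le> (norm ((y - z) - b *\<^sub>R g))\<^sup>2"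
    by (intro power_mono) (simp_all add: algebra_simps)
  also have "\<dots> = (norm (y - z))\<^sup>2 - 2 * b * (g \<bullet> (y - z)) + b\<^sup>2 * (norm g)\<^sup>2"
    unfolding power2_norm_eq_inner
    by (simp add: inner_diff_left inner_diff_right inner_commute power2_eq_square algebra_simps)
  finally show ?thesis .
qed

text \<open>The iterate \<open>(y, s)\<close> is fixed and only the batch is random. By linearity
  the mean of \<open>g\<close> enters the inner product, and \<open>joint_subgradient\<close>
  compares with \<open>(z, r)\<close> for any \<open>r\<close>, so the \<open>t\<close>-component
  adds no error term.\<close>

lemma (in block_objective) expected_step_le:
  fixes g :: "'b \<Rightarrow> real^'d" and M :: "'s measure"
  assumes M: "prob_space M" and W: "W \<in> M \<rightarrow>\<^sub>M count_space S" "finite S"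
    and X: "closed X" and y: "y \<in> X" and z: "z \<in> X" and b: "0 \<le> b"
    and s: "is_arg_min (f y) (\<lambda>_. True) s"
    and g: "(\<integral>\<omega>. g (W \<omega>) \<partial>M) \<in> subdifferential X (\<lambda>z. f z s) y"
    and B: "(\<integral>\<omega>. (norm (g (W \<omega>)))\<^sup>2 \<partial>M) \<le> B\<^sup>2"
  shows "(\<integral>\<omega>. (norm (closest_point X (y - b *\<^sub>R g (W \<omega>)) - z))\<^sup>2 \<partial>M)
    \<le> (norm (y - z))\<^sup>2 - 2 * b * (f y s - f z r) + b\<^sup>2 * B\<^sup>2"
proof -
  interpret prob_space M by fact
  have int: "integrable M (\<lambda>\<omega>. \<phi> (W \<omega>))" for \<phi> :: "'b \<Rightarrow> 'c::{banach, second_countable_topology}"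
    by (rule integrable_factor[OF W]) simp
  let ?E = "expectation (\<lambda>\<omega>. g (W \<omega>))"
  have "expectation (\<lambda>\<omega>. (norm (closest_point X (y - b *\<^sub>R g (W \<omega>)) - z))\<^sup>2)
    \<le> expectation (\<lambda>\<omega>. (norm (y - z))\<^sup>2 - 2 * b * (g (W \<omega>) \<bullet> (y - z)) + b\<^sup>2 * (norm (g (W \<omega>)))\<^sup>2)"
    by (intro integral_mono int norm_projected_step_le X convex_X z)
  also have "\<dots> = (norm (y - z))\<^sup>2 - 2 * b * (?E \<bullet> (y - z)) + b\<^sup>2 * expectation (\<lambda>\<omega>. (norm (g (W \<omega>)))\<^sup>2)"
    using int[of g] int[of "\<lambda>w. (norm (g w))\<^sup>2"] int[of "\<lambda>w. g w \<bullet> (y - z)"] by (simp add: prob_space)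
  also have "\<dots> \<le> (norm (y - z))\<^sup>2 - 2 * b * (f y s - f z r) + b\<^sup>2 * B\<^sup>2"
  proof -
    have "f y s - f z r \<le> ?E \<bullet> (y - z)"
      using joint_subgradient[OF y z g s, of r] by (simp add: inner_diff_right)
    then have "2 * b * (f y s - f z r) \<le> 2 * b * (?E \<bullet> (y - z))"
      using b by (intro mult_left_mono) auto
    moreover have "b\<^sup>2 * expectation (\<lambda>\<omega>. (norm (g (W \<omega>)))\<^sup>2) \<le> b\<^sup>2 * B\<^sup>2"
      using B by (intro mult_left_mono) auto
    ultimately show ?thesis by linarith
  qed
  finally show ?thesis .
qed

text \<open>Jensen's inequality in the product space: both averages come from one convex combination
  of the pairs \<open>(x j, t j)\<close>.\<close>

lemma (in block_objective) f_average_le: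
  assumes T: "1 \<le> T" and x: "\<And>j. j < T \<Longrightarrow> x j \<in> X"
  shows "f ((1 / real T) *\<^sub>R (\<Sum>j<T. x j)) ((1 / real T) * (\<Sum>j<T. t j))
    \<le> 1 / real T * (\<Sum>j<T. f (x j) (t j))"
proof -
  have "f (fst (\<Sum>j<T. (1 / real T) *\<^sub>R (x j, t j))) (snd (\<Sum>j<T. (1 / real T) *\<^sub>R (x j, t j)))
    \<le> (\<Sum>j<T. 1 / real T * f (fst (x j, t j)) (snd (x j, t j)))"
    by (rule convex_on_sum[OF _ _ convex_on_f]) (use assms in \<open>auto simp: lessThan_empty_iff bot_nat_def\<close>)
  then show ?thesis
    by (simp add: fst_sum snd_sum sum_distrib_left scaleR_sum_right)
qed

section \<open>Histories of draws and the ergodic bound\<close>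

text \<open>The restriction makes the value an element of a \<open>PiE\<close> set, which is finite
  when \<open>K\<close> and the index type are.\<close>

definition draws :: "(nat \<Rightarrow> nat \<Rightarrow> 's \<Rightarrow> 'n) \<Rightarrow> (nat \<times> nat) set \<Rightarrow> 's \<Rightarrow> nat \<times> nat \<Rightarrow> 'n" where
  "draws \<xi> K \<omega> = restrict (\<lambda>(j, k). \<xi> j k \<omega>) K"

lemma draws_eq_iff: "draws \<xi> K \<omega> = draws \<xi> K \<omega>' \<longleftrightarrow> (\<forall>(j, k)\<in>K. \<xi> j k \<omega> = \<xi> j k \<omega>')"
  by (auto simp: draws_def fun_eq_iff restrict_def)

text \<open>The batch depends on the outcome only through the draws of its own iteration.\<close>

lemma minibatch_eq_draws:
  "minibatch m \<xi> j \<omega> = image_mset (\<lambda>k. draws \<xi> ({j} \<times> {..<m j}) \<omega> (j, k)) (mset_set {..<m j})"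
  unfolding minibatch_def by (rule image_mset_cong) (simp add: draws_def)

theorem theorem3p1:
  fixes p q :: "real^'n"
    and \<alpha> \<gamma> B R :: real
    and X :: "(real^'d) set"
    and F :: "real^'d \<Rightarrow> 'n \<Rightarrow> real"
    and \<B> :: "'n set"
    and \<beta> :: "nat \<Rightarrow> real"
    and T :: nat
    and M :: "'s measure"
    and m :: "nat \<Rightarrow> nat"
    and \<xi> :: "nat \<Rightarrow> nat \<Rightarrow> 's \<Rightarrow> 'n"
    and G :: "real^'d \<Rightarrow> real \<Rightarrow> 'n multiset \<Rightarrow> real^'d"
    and x0 xstar :: "real^'d"
    and x :: "nat \<Rightarrow> 's \<Rightarrow> real^'d"
    and t :: "nat \<Rightarrow> 's \<Rightarrow> real"
  assumes p: "prob_vector p"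
    and alpha: "0 < \<alpha>" "\<alpha> < 1"
    and X: "closed X" "convex X" "X \<noteq> {}"
    and F: "\<And>i. convex_on X (\<lambda>y. F y i)"
    and q: "q \<in> int_Q \<alpha> p"
    and gamma: "0 < \<gamma>"
    and block: "2 \<le> card \<B>"
    and T: "1 \<le> T"
    and beta_pos: "\<And>j. j < T \<Longrightarrow> 0 < \<beta> j"
    and beta_noninc: "\<And>j. Suc j < T \<Longrightarrow> \<beta> (Suc j) \<le> \<beta> j"
    and sampling: "minibatch_sampling M q T m \<xi>"
    and unbiased: "\<And>j y s. j < T \<Longrightarrow> y \<in> X \<Longrightarrow>
      prob_space.expectation M (\<lambda>\<omega>. G y s (minibatch m \<xi> j \<omega>))
        \<in> subdifferential X (\<lambda>z. fB \<alpha> p \<gamma> F \<B> q z s) y"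
    and x0: "x0 \<in> X"
    and x_0: "\<And>\<omega>. \<omega> \<in> space M \<Longrightarrow> x 0 \<omega> = x0"
    and t_argmin: "\<And>j \<omega>. j \<le> T \<Longrightarrow> \<omega> \<in> space M \<Longrightarrow>
      is_arg_min (\<lambda>s. fB \<alpha> p \<gamma> F \<B> q (x j \<omega>) s) (\<lambda>_. True) (t j \<omega>)"
    and x_Suc: "\<And>j \<omega>. j < T \<Longrightarrow> \<omega> \<in> space M \<Longrightarrow>
      x (Suc j) \<omega> =
        closest_point X (x j \<omega> - \<beta> j *\<^sub>R G (x j \<omega>) (t j \<omega>) (minibatch m \<xi> j \<omega>))"
    and second_moment: "\<And>j y s. j < T \<Longrightarrow> y \<in> X \<Longrightarrow>
      prob_space.expectation M (\<lambda>\<omega>. (norm (G y s (minibatch m \<xi> j \<omega>)))\<^sup>2) \<le> B\<^sup>2"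
    and xstar: "is_arg_min (fB_hat \<alpha> p \<gamma> F \<B> q) (\<lambda>y. y \<in> X) xstar"
    and bounded_domain: "\<And>y. y \<in> X \<Longrightarrow> (norm (y - xstar))\<^sup>2 \<le> R\<^sup>2"
  shows "prob_space.expectation M
      (\<lambda>\<omega>. fB \<alpha> p \<gamma> F \<B> q
              ((1 / real T) *\<^sub>R (\<Sum>j<T. x j \<omega>)) ((1 / real T) * (\<Sum>j<T. t j \<omega>))
            - fB_star \<alpha> p \<gamma> F \<B> q X)
    \<le> R\<^sup>2 / (2 * real T * \<beta> (T - 1)) + 1 / (2 * real T) * (\<Sum>j<T. \<beta> j * B\<^sup>2)"
proof -
  interpret prob_space M
    using sampling by (simp add: minibatch_sampling_def)
  have "\<B> \<noteq> {}"
    using block by auto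
  then interpret block_objective \<alpha> \<gamma> p q F \<B> X
    by unfold_locales (use alpha gamma q X F in auto)
  have xsX: "xstar \<in> X"
    using xstar by (simp add: is_arg_min_def)
  obtain ts where ts: "is_arg_min (f xstar) (\<lambda>_. True) ts"
    using arg_min_exists by blast
  have star: "fB_star \<alpha> p \<gamma> F \<B> q X = f xstar ts"
    by (rule fB_star_eq[OF xstar ts])
  have xX: "x j \<omega> \<in> X" if "j \<le> T" "\<omega> \<in> space M" for j \<omega>
    using that x0 x_0 x_Suc closest_point_in_set[OF X(1,3)] by (cases j) auto

  \<comment> \<open>\<open>K j\<close> indexes the draws strictly before iteration \<open>j\<close>,
    \<open>L j\<close> those of iteration \<open>j\<close>. The two are disjoint, so the history
    \<open>V j\<close> and the current draws \<open>W j\<close> are independent.\<close>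
  define K where "K j = (SIGMA i:{..<j}. {..<m i})" for j
  define L where "L j = {j} \<times> {..<m j}" for j :: nat
  have fin: "finite (K j)" "finite (L j)" for j
    by (auto simp: K_def L_def)
  define V where "V j = draws \<xi> (K j)" for j
  define W where "W j = draws \<xi> (L j)" for j
  \<comment> \<open>Over finitely many draws the product sigma-algebra is discrete, as the lemmas on
    finitely valued variables require.\<close>
  have count: "PiM J (\<lambda>_. count_space UNIV) = count_space (PiE J (\<lambda>_. UNIV :: 'n set))"
    and fin_PiE: "finite (PiE J (\<lambda>_. UNIV :: 'n set))" if "finite J" for J :: "(nat \<times> nat) set"
    using that by (auto intro: count_space_PiM_finite finite_PiE)
  have indep_all: "indep_vars (\<lambda>_. count_space UNIV) (\<lambda>(j, k). \<xi> j k) (K T)"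
    using sampling by (simp add: minibatch_sampling_def K_def)
  have indep: "indep_var (count_space (PiE (K j) (\<lambda>_. UNIV))) (V j) (count_space (PiE (L j) (\<lambda>_. UNIV))) (W j)"
    if "j < T" for j
  proof -
    have "K j \<inter> L j = {}" "K j \<subseteq> K T" "L j \<subseteq> K T"
      using that by (auto simp: K_def L_def)
    from indep_var_restrict[OF indep_all this] show ?thesis
      unfolding V_def W_def draws_def[abs_def] count[OF fin(1)] count[OF fin(2)]
      by (simp add: split_beta')
  qed
  have VT: "V T \<in> M \<rightarrow>\<^sub>M count_space (PiE (K T) (\<lambda>_. UNIV))"
    unfolding V_def draws_def[abs_def] count[OF fin(1), symmetric]
    using indep_all by (intro measurable_restrict) (auto simp: indep_vars_def2)
  \<comment> \<open>The draws determine \<open>x j\<close> by induction, and then \<open>t j\<close>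
    because the minimiser in \<open>t\<close> is unique.\<close>
  have history: "x j \<omega> = x j \<omega>' \<and> t j \<omega> = t j \<omega>'"
    if "j \<le> T" "\<omega> \<in> space M" "\<omega>' \<in> space M" "V j \<omega> = V j \<omega>'" for j \<omega> \<omega>'
  proof -
    have "x j \<omega> = x j \<omega>'"
      using that
    proof (induction j)
      case 0
      then show ?case by (simp add: x_0)
    next
      case (Suc j)
      \<comment> \<open>\<open>K (Suc j)\<close> is the union of \<open>K j\<close> and
        \<open>L j\<close>.\<close>
      have VW: "V j \<omega> = V j \<omega>'" "W j \<omega> = W j \<omega>'"
        using Suc.prems(4) by (auto simp: V_def W_def draws_eq_iff K_def L_def)
      then have x: "x j \<omega> = x j \<omega>'"
        using Suc by simp
      moreover have "t j \<omega> = t j \<omega>'"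
        using t_argmin[of j \<omega>] t_argmin[of j \<omega>'] x Suc.prems arg_min_unique by simp
      moreover have "minibatch m \<xi> j \<omega> = minibatch m \<xi> j \<omega>'"
        using VW(2) by (simp add: minibatch_eq_draws W_def L_def)
      ultimately show ?case
        using Suc.prems by (simp add: x_Suc)
    qed
    then show ?thesis
      using t_argmin[of j \<omega>] t_argmin[of j \<omega>'] that arg_min_unique by simp
  qed
  \<comment> \<open>Whatever is read off the iterates up to \<open>T\<close> is a function of
    \<open>V T\<close>, hence integrable.\<close>
  have int: "integrable M \<phi>"
    if "\<And>\<omega> \<omega>'. \<omega> \<in> space M \<Longrightarrow> \<omega>' \<in> space M \<Longrightarrow> (\<And>j. j \<le> T \<Longrightarrow> x j \<omega> = x j \<omega>' \<and> t j \<omega> = t j \<omega>')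
      \<Longrightarrow> \<phi> \<omega> = \<phi> \<omega>'" for \<phi> :: "'s \<Rightarrow> real"
  proof (rule integrable_factor[OF VT fin_PiE[OF fin(1)]])
    fix \<omega> \<omega>' assume *: "\<omega> \<in> space M" "\<omega>' \<in> space M" "V T \<omega> = V T \<omega>'"
    have "V j \<omega> = V j \<omega>'" if "j \<le> T" for j
      using *(3) that by (auto simp: V_def draws_eq_iff K_def)
    with * show "\<phi> \<omega> = \<phi> \<omega>'"
      by (intro that history) auto
  qed

  \<comment> \<open>The one-step estimate in expectation\<close>
  define D where "D j = expectation (\<lambda>\<omega>. (norm (x j \<omega> - xstar))\<^sup>2)" for j
  define e where "e j = expectation (\<lambda>\<omega>. f (x j \<omega>) (t j \<omega>) - f xstar ts)" for j
  have int_D: "integrable M (\<lambda>\<omega>. (norm (x j \<omega> - xstar))\<^sup>2)" if "j \<le> T" for j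
    using that by (intro int) simp
  have int_e: "integrable M (\<lambda>\<omega>. f (x j \<omega>) (t j \<omega>) - f xstar ts)" if "j \<le> T" for j
    using that by (intro int) simp
  have step: "D (Suc j) - D j + 2 * \<beta> j * e j \<le> (\<beta> j)\<^sup>2 * B\<^sup>2" if j: "j < T" for j
  proof -
    define batch where "batch w = image_mset (\<lambda>k. w (j, k)) (mset_set {..<m j})" for w :: "nat \<times> nat \<Rightarrow> 'n"
    have batch: "minibatch m \<xi> j \<omega> = batch (W j \<omega>)" for \<omega>
      by (simp add: minibatch_eq_draws batch_def W_def L_def)
    \<comment> \<open>\<open>a v\<close> is an outcome with history \<open>v\<close>. It turns the
      iterates into functions of the history, so that \<open>\<psi>\<close> takes history and draws
      as separate arguments.\<close>
    define a where "a v = inv_into (space M) (V j) v" for v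
    have a: "x j (a (V j \<omega>)) = x j \<omega>" "t j (a (V j \<omega>)) = t j \<omega>" if "\<omega> \<in> space M" for \<omega>
      using history[of j "a (V j \<omega>)" \<omega>] that j
      by (auto simp: a_def f_inv_into_f inv_into_into)
    define \<psi> where "\<psi> v w = (norm (closest_point X (x j (a v) - \<beta> j *\<^sub>R G (x j (a v)) (t j (a v)) (batch w)) - xstar))\<^sup>2
      - (norm (x j (a v) - xstar))\<^sup>2 + 2 * \<beta> j * (f (x j (a v)) (t j (a v)) - f xstar ts)" for v w
    have Wm: "W j \<in> M \<rightarrow>\<^sub>M count_space (PiE (L j) (\<lambda>_. UNIV))"
      using indep_var_rv2[OF indep[OF j]] .
    have "D (Suc j) - D j + 2 * \<beta> j * e j = expectation (\<lambda>\<omega>. (norm (x (Suc j) \<omega> - xstar))\<^sup>2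
      - (norm (x j \<omega> - xstar))\<^sup>2 + 2 * \<beta> j * (f (x j \<omega>) (t j \<omega>) - f xstar ts))"
      unfolding D_def e_def using int_D[of j] int_D[of "Suc j"] int_e[of j] j by simp
    also have "\<dots> = expectation (\<lambda>\<omega>. \<psi> (V j \<omega>) (W j \<omega>))"
      by (rule Bochner_Integration.integral_cong[OF refl]) (simp add: \<psi>_def a x_Suc[OF j] batch)
    also have "\<dots> \<le> (\<beta> j)\<^sup>2 * B\<^sup>2"
    \<comment> \<open>With the history frozen at \<open>\<omega>\<close>, the iterate is a constant
      point of \<open>X\<close>, so \<open>unbiased\<close> and \<open>second_moment\<close>, which
      speak of fixed arguments, apply.\<close>
    proof (rule expectation_freeze_le[OF indep[OF j] fin_PiE[OF fin(1)] fin_PiE[OF fin(2)]])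
      fix \<omega> assume \<omega>: "\<omega> \<in> space M"
      let ?g = "\<lambda>w. G (x j \<omega>) (t j \<omega>) (batch w)"
      let ?n = "\<lambda>\<omega>'. (norm (closest_point X (x j \<omega> - \<beta> j *\<^sub>R ?g (W j \<omega>')) - xstar))\<^sup>2"
      have xj: "x j \<omega> \<in> X"
        using xX j \<omega> by simp
      have "expectation ?n \<le> (norm (x j \<omega> - xstar))\<^sup>2 - 2 * \<beta> j * (f (x j \<omega>) (t j \<omega>) - f xstar ts) + (\<beta> j)\<^sup>2 * B\<^sup>2"
      proof (rule expected_step_le[OF prob_space_axioms Wm fin_PiE[OF fin(2)] X(1) xj xsX])
        show "0 \<le> \<beta> j"
          using beta_pos[OF j] by simp
        show "is_arg_min (f (x j \<omega>)) (\<lambda>_. True) (t j \<omega>)"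
          using t_argmin[of j \<omega>] j \<omega> by simp
        show "expectation (\<lambda>\<omega>'. ?g (W j \<omega>')) \<in> subdifferential X (\<lambda>z. f z (t j \<omega>)) (x j \<omega>)"
          using unbiased[OF j xj] by (simp add: batch)
        show "expectation (\<lambda>\<omega>'. (norm (?g (W j \<omega>')))\<^sup>2) \<le> B\<^sup>2"
          using second_moment[OF j xj] by (simp add: batch)
      qed
      moreover have "integrable M ?n"
        by (rule integrable_factor[OF Wm fin_PiE[OF fin(2)]]) simp
      ultimately show "expectation (\<lambda>\<omega>'. \<psi> (V j \<omega>) (W j \<omega>')) \<le> (\<beta> j)\<^sup>2 * B\<^sup>2"
        unfolding \<psi>_def by (simp add: a \<omega> prob_space)
    qed
    finally show ?thesis .
  qed

  \<comment> \<open>Summation over the iterations and averaging\<close>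
  \<comment> \<open>Dividing by \<open>2 * \<beta> j\<close> frees \<open>e j\<close> of its weight,
    as the ergodic averages are unweighted.\<close>
  have e_le: "e j \<le> 1 / 2 * ((D j - D (Suc j)) / \<beta> j) + 1 / 2 * (\<beta> j * B\<^sup>2)" if "j < T" for j
    using step[OF that] beta_pos[OF that] by (simp add: field_simps power2_eq_square)
  \<comment> \<open>The last step has index \<open>n = T - 1\<close>; its step size is the one left
    in the denominator.\<close>
  obtain n where n: "T = Suc n"
    using T by (cases T) auto
  have D_nonneg: "0 \<le> D j" for j
    unfolding D_def by (intro integral_nonneg_AE) simp
  have D_le: "D j \<le> R\<^sup>2" if "j \<le> T" for j
  proof -
    have "D j \<le> expectation (\<lambda>\<omega>. R\<^sup>2)"
      unfolding D_def using that xX bounded_domain by (intro integral_mono int_D) auto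
    then show ?thesis
      by (simp add: prob_space)
  qed
  have "(\<Sum>j<T. (D j - D (Suc j)) / \<beta> j) \<le> (R\<^sup>2 - D T) / \<beta> (T - 1)"
    using telescoping_weighted_le[of n \<beta> D "R\<^sup>2"] beta_pos beta_noninc D_le
    by (simp add: n lessThan_Suc_atMost)
  also have "\<dots> \<le> R\<^sup>2 / \<beta> (T - 1)"
    using beta_pos[of "T - 1"] D_nonneg[of T] n by (intro divide_right_mono) auto
  finally have tele: "(\<Sum>j<T. (D j - D (Suc j)) / \<beta> j) \<le> R\<^sup>2 / \<beta> (T - 1)" .

  have "expectation (\<lambda>\<omega>. f ((1 / real T) *\<^sub>R (\<Sum>j<T. x j \<omega>)) ((1 / real T) * (\<Sum>j<T. t j \<omega>)) - f xstar ts)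
    \<le> expectation (\<lambda>\<omega>. 1 / real T * (\<Sum>j<T. f (x j \<omega>) (t j \<omega>) - f xstar ts))"
  proof (rule integral_mono)
    show "integrable M (\<lambda>\<omega>. f ((1 / real T) *\<^sub>R (\<Sum>j<T. x j \<omega>)) ((1 / real T) * (\<Sum>j<T. t j \<omega>)) - f xstar ts)"
      by (rule int) simp
    show "integrable M (\<lambda>\<omega>. 1 / real T * (\<Sum>j<T. f (x j \<omega>) (t j \<omega>) - f xstar ts))"
      by (rule int) simp
    fix \<omega> assume "\<omega> \<in> space M"
    then have "f ((1 / real T) *\<^sub>R (\<Sum>j<T. x j \<omega>)) ((1 / real T) * (\<Sum>j<T. t j \<omega>))
      \<le> 1 / real T * (\<Sum>j<T. f (x j \<omega>) (t j \<omega>))"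
      using xX by (intro f_average_le[OF T]) auto
    then show "f ((1 / real T) *\<^sub>R (\<Sum>j<T. x j \<omega>)) ((1 / real T) * (\<Sum>j<T. t j \<omega>)) - f xstar ts
      \<le> 1 / real T * (\<Sum>j<T. f (x j \<omega>) (t j \<omega>) - f xstar ts)"
      using T by (simp add: sum_subtractf right_diff_distrib)
  qed
  also have "\<dots> = 1 / real T * (\<Sum>j<T. e j)"
    unfolding e_def using int_e by (simp add: Bochner_Integration.integral_sum)
  also have "\<dots> \<le> 1 / real T * (\<Sum>j<T. 1 / 2 * ((D j - D (Suc j)) / \<beta> j) + 1 / 2 * (\<beta> j * B\<^sup>2))"
    by (intro mult_left_mono sum_mono e_le) auto
  also have "\<dots> = 1 / (2 * real T) * (\<Sum>j<T. (D j - D (Suc j)) / \<beta> j) + 1 / (2 * real T) * (\<Sum>j<T. \<beta> j * B\<^sup>2)"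
    unfolding sum.distrib sum_distrib_left[symmetric] by (simp add: distrib_left)
  also have "\<dots> \<le> 1 / (2 * real T) * (R\<^sup>2 / \<beta> (T - 1)) + 1 / (2 * real T) * (\<Sum>j<T. \<beta> j * B\<^sup>2)"
    using tele by (intro add_right_mono mult_left_mono) auto
  also have "\<dots> = R\<^sup>2 / (2 * real T * \<beta> (T - 1)) + 1 / (2 * real T) * (\<Sum>j<T. \<beta> j * B\<^sup>2)"
    by simp
  finally show ?thesis
    by (simp only: star)
qed

end
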